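(* Let $S=(2,2,2,\ldots)$ be the infinite sequence with $a_i=2$ for all $i\geq 1$, and let $n\geq 3$. Then $$\chi_S''(C_n)=\begin{cases}5, & n\equiv 0\pmod 5,\\ 6, & n\not\equiv 0\pmod 5 \text{ and } n\notin\{4,7\},\\ 7, & n=7,\\ 8, & n=4.\end{cases}$$
   Context: $C_n$ is the cycle on $n$ vertices. For vertices $u,v$ of a graph $G$, $d(u,v)$ is the usual shortest-path distance. For a vertex $u$ and an edge $ab$, $d(u,ab)=d(ab,u)=\min\{d(u,a),d(u,b)\}+1$. For two distinct edges $ab,cd$, $d(ab,cd)=\min\{d(a,c),d(a,d),d(b,c),d(b,d)\}+1$. For a non-decreasing infinite sequence $S=(a_1,a_2,\ldots)$ of positive integers, an $S$-packing total coloring of $G$ using $k$ colors is a map $c:V(G)\cup E(G)\to\{1,\ldots,k\}$ such that any two distinct elements $A,B\in V(G)\cup E(G)$ with $c(A)=c(B)=i$ satisfy $d(A,B)>a_i$. The $S$-packing total chromatic number $\chi_S''(G)$ is the smallest $k$ for which one exists. *)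

theory Defs
  imports Main "HOL-Library.Extended_Nat"
begin

record 'a graph =
  verts :: "'a set"
  edges :: "'a set set"

definition simple_graph :: "'a graph \<Rightarrow> bool" where
  "simple_graph G \<longleftrightarrow> (\<forall>e\<in>edges G. e \<subseteq> verts G \<and> card e = 2)"

definition is_path :: "'a graph \<Rightarrow> 'a list \<Rightarrow> bool" where
  "is_path G p \<longleftrightarrow>
     p \<noteq> [] \<and> set p \<subseteq> verts G \<and> distinct p \<and> successively (\<lambda>x y. {x, y} \<in> edges G) p"

text \<open>A path with \<open>m\<close> vertices has \<open>m - 1\<close> edges. The infimum is \<open>\<infinity>\<close> if
  no path connects the two vertices.\<close>

definition vdist :: "'a graph \<Rightarrow> 'a \<Rightarrow> 'a \<Rightarrow> enat" where
  "vdist G u v = (INF p\<in>{p. is_path G p \<and> hd p = u \<and> last p = v}. enat (length p - 1))"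

datatype 'a element = Vertex 'a | Edge "'a set"

definition elements :: "'a graph \<Rightarrow> 'a element set" where
  "elements G = Vertex ` verts G \<union> Edge ` edges G"

fun edist :: "'a graph \<Rightarrow> 'a element \<Rightarrow> 'a element \<Rightarrow> enat" where
  "edist G (Vertex u) (Vertex v) = vdist G u v"
| "edist G (Vertex u) (Edge e) = (INF x\<in>e. vdist G u x) + 1"
| "edist G (Edge e) (Vertex u) = (INF x\<in>e. vdist G u x) + 1"
| "edist G (Edge e) (Edge f) = (INF x\<in>e. INF y\<in>f. vdist G x y) + 1"

text \<open>The sequence \<open>(a\<^sub>1, a\<^sub>2, \<dots>)\<close> is the function \<open>S\<close> with \<open>S i = a\<^sub>i\<close> for \<open>i \<ge> 1\<close>;
  the value \<open>S 0\<close> is never used.\<close>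

definition packing_sequence :: "(nat \<Rightarrow> nat) \<Rightarrow> bool" where
  "packing_sequence S \<longleftrightarrow> (\<forall>i\<ge>1. 0 < S i \<and> S i \<le> S (Suc i))"

definition packing_total_coloring ::
  "(nat \<Rightarrow> nat) \<Rightarrow> 'a graph \<Rightarrow> nat \<Rightarrow> ('a element \<Rightarrow> nat) \<Rightarrow> bool" where
  "packing_total_coloring S G k c \<longleftrightarrow>
     packing_sequence S \<and> c ` elements G \<subseteq> {1..k} \<and>
     (\<forall>A\<in>elements G. \<forall>B\<in>elements G. A \<noteq> B \<and> c A = c B \<longrightarrow> edist G A B > enat (S (c A)))"

definition packing_total_chromatic_number :: "(nat \<Rightarrow> nat) \<Rightarrow> 'a graph \<Rightarrow> nat" where
  "packing_total_chromatic_number S G = (LEAST k. \<exists>c. packing_total_coloring S G k c)"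

definition cycle_graph :: "nat \<Rightarrow> nat graph" where
  "cycle_graph n = \<lparr>verts = {..<n}, edges = {{i, (i + 1) mod n} |i. i < n}\<rparr>"

lemma simple_cycle_graph:
  assumes "n \<ge> 3"
  shows "simple_graph (cycle_graph n)"
proof -
  have "i \<noteq> Suc i mod n" if "i < n" for i
    using that assms by (cases "Suc i = n") auto
  then show ?thesis
    using assms by (simp add: simple_graph_def cycle_graph_def) (fastforce simp: card_insert_if)
qed

text \<open>The minimum defining the chromatic number exists for every finite graph.\<close>

lemma packing_total_coloring_exists:
  assumes "packing_sequence S" and "finite (verts G)" and "simple_graph G"
  shows "\<exists>k c. packing_total_coloring S G k c"
proof -
  have "edges G \<subseteq> Pow (verts G)"
    using assms(3) by (auto simp: simple_graph_def)
  then have "finite (elements G)"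
    using assms(2) by (auto simp: elements_def intro: finite_subset)
  then obtain c where "bij_betw c (elements G) {1..card (elements G)}"
    using finite_same_card_bij[of "elements G" "{1..card (elements G)}"] by auto
  then have "packing_total_coloring S G (card (elements G)) c"
    using assms(1) by (auto simp: packing_total_coloring_def bij_betw_def inj_on_def)
  then show ?thesis by blast
qed

end

theory Submission
  imports Defs
begin

text \<open>
  List the vertices and edges of \<open>C\<^sub>n\<close> alternately, in the order in which they occur around the
  cycle. This arranges the elements on a cycle of \<open>N = 2n\<close> positions, and the distance of two
  distinct elements is half their distance along this cycle, rounded up
  (\<open>edist_cycle_le_iff\<close>). So two elements may share a colour exactly if their positions differ by
  at least 5, and a colouring is the same as a word of period \<open>N\<close> in which any five consecutive
  letters are distinct (\<open>ex_coloring_iff_ex_rainbow_word\<close>). Words are indexed by the integers, so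
  that no window of letters has to be treated specially where the cycle closes up.

  Lower bound: the occurrences of one letter lie at least 5 apart on a cycle of length \<open>N\<close>, so
  there are at most \<open>N div 5\<close> of them, and \<open>k\<close> letters fill at most \<open>k * (N div 5)\<close> positions
  (\<open>rainbow_word_period_le\<close>). This single count gives \<open>k \<ge> 5\<close> always, \<open>k \<ge> 6\<close> unless
  5 divides \<open>N\<close>, \<open>k \<ge> 7\<close> for \<open>N = 14\<close> and \<open>k \<ge> 8\<close> for \<open>N = 8\<close>.

  Upper bound: if \<open>m \<ge> 5\<close> divides \<open>N\<close>, then repeating \<open>1, \<dots>, m\<close> gives a word with \<open>m\<close>
  letters; this covers \<open>m = 5\<close>, \<open>N = 14\<close> and \<open>N = 8\<close>. Otherwise \<open>N\<close> is a sum of fives and sixes,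
  and blocks \<open>1, \<dots>, 5\<close> and \<open>1, \<dots>, 6\<close> may be concatenated freely: equal letters in consecutive
  blocks are at least 5 apart (\<open>rainbow_word_blocks\<close>).
\<close>

section \<open>The elements of a cycle in cyclic order\<close>

definition cycle_vertex :: "nat \<Rightarrow> int \<Rightarrow> nat" where
  "cycle_vertex n u = nat (u mod int n)"

text \<open>Even positions carry the vertices; the position between two vertices carries the edge that
  joins them.\<close>

definition cycle_element :: "nat \<Rightarrow> int \<Rightarrow> nat element" where
  "cycle_element n p =
     (if even p then Vertex (cycle_vertex n (p div 2))
      else Edge {cycle_vertex n (p div 2), cycle_vertex n (p div 2 + 1)})"

lemma cycle_vertex_eq_iff:
  assumes "n > 0"
  shows "cycle_vertex n u = cycle_vertex n v \<longleftrightarrow> int n dvd v - u"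
proof -
  have "cycle_vertex n u = cycle_vertex n v \<longleftrightarrow> u mod int n = v mod int n"
    using assms by (simp add: cycle_vertex_def nat_eq_iff)
  also have "\<dots> \<longleftrightarrow> int n dvd v - u"
    unfolding mod_eq_dvd_iff by (rule dvd_diff_commute)
  finally show ?thesis .
qed

lemma cycle_vertex_less: "n > 0 \<Longrightarrow> cycle_vertex n u < n"
  by (simp add: cycle_vertex_def nat_less_iff)

lemma cycle_vertex_of_nat: "i < n \<Longrightarrow> cycle_vertex n (int i) = i"
  by (simp add: cycle_vertex_def)

lemma cycle_vertex_Suc: "cycle_vertex n (int i + 1) = (i + 1) mod n"
proof -
  have "int i + 1 = int (i + 1)" by simp
  then show ?thesis by (simp only: cycle_vertex_def zmod_int[symmetric] nat_int)
qed

lemma verts_cycle_graph: "n > 0 \<Longrightarrow> verts (cycle_graph n) = range (cycle_vertex n)"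
  by (auto simp: cycle_graph_def cycle_vertex_less) (metis cycle_vertex_of_nat rangeI)

lemma edges_cycle_graph:
  assumes "n > 0"
  shows "edges (cycle_graph n) = range (\<lambda>u. {cycle_vertex n u, cycle_vertex n (u + 1)})"
    (is "_ = ?R")
proof
  show "edges (cycle_graph n) \<subseteq> ?R"
  proof
    fix e assume "e \<in> edges (cycle_graph n)"
    then obtain i where "i < n" "e = {i, (i + 1) mod n}"
      by (auto simp: cycle_graph_def)
    then have "e = {cycle_vertex n (int i), cycle_vertex n (int i + 1)}"
      by (simp only: cycle_vertex_of_nat cycle_vertex_Suc)
    then show "e \<in> ?R" by blast
  qed
  show "?R \<subseteq> edges (cycle_graph n)"
  proof
    fix e assume "e \<in> ?R"
    then obtain u where u: "e = {cycle_vertex n u, cycle_vertex n (u + 1)}" by blast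
    define i where "i = cycle_vertex n u"
    have i: "i < n" using assms by (simp add: i_def cycle_vertex_less)
    then have "cycle_vertex n (int i) = cycle_vertex n u"
      by (simp add: cycle_vertex_of_nat i_def)
    then have "cycle_vertex n (u + 1) = cycle_vertex n (int i + 1)"
      using assms by (simp add: cycle_vertex_eq_iff dvd_diff_commute)
    then have "e = {i, (i + 1) mod n}"
      using u by (simp only: cycle_vertex_Suc i_def)
    then show "e \<in> edges (cycle_graph n)"
      using i by (auto simp: cycle_graph_def)
  qed
qed

lemma elements_cycle_graph:
  assumes "n > 0"
  shows "elements (cycle_graph n) = range (cycle_element n)" (is "?L = ?R")
proof
  show "?L \<subseteq> ?R"
  proof
    fix A assume "A \<in> ?L"
    then consider u where "A = Vertex (cycle_vertex n u)"
      | u where "A = Edge {cycle_vertex n u, cycle_vertex n (u + 1)}"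
      using assms by (auto simp: elements_def verts_cycle_graph edges_cycle_graph)
    then show "A \<in> ?R"
    proof cases
      case 1
      then have "A = cycle_element n (2 * u)" by (simp add: cycle_element_def)
      then show ?thesis by blast
    next
      case 2
      then have "A = cycle_element n (2 * u + 1)" by (simp add: cycle_element_def)
      then show ?thesis by blast
    qed
  qed
  show "?R \<subseteq> ?L"
    using assms by (auto simp: elements_def verts_cycle_graph edges_cycle_graph cycle_element_def)
qed

lemma two_times_dvd_diff_iff: "(2 * m dvd 2 * a - 2 * b) \<longleftrightarrow> (m dvd a - (b::int))"
  by (simp only: right_diff_distrib[symmetric] dvd_mult_cancel_left) simp

lemma cycle_element_eq_iff:
  assumes "n \<ge> 3"
  shows "cycle_element n p = cycle_element n q \<longleftrightarrow> p mod (2 * int n) = q mod (2 * int n)"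
proof -
  have n: "n > 0" using assms by simp
  have "cycle_element n p = cycle_element n q \<longleftrightarrow> 2 * int n dvd q - p"
  proof (cases "even p = even q")
    case True
    then have "p mod 2 = q mod 2" by (simp add: mod_2_eq_odd)
    then have "q - p = 2 * (q div 2) - 2 * (p div 2)"
      using mult_div_mod_eq[of 2 p] mult_div_mod_eq[of 2 q] by linarith
    then have pos: "2 * int n dvd q - p \<longleftrightarrow> int n dvd q div 2 - p div 2"
      by (simp only: two_times_dvd_diff_iff)
    \<comment> \<open>An edge is determined by its first end: two edges matched crosswise would force
      \<open>n\<close> to divide 2.\<close>
    have cross: False
      if "int n dvd v + 1 - u" "int n dvd v - (u + 1)" for u v
    proof -
      have "int n dvd 2" using dvd_diff[OF that] by simp
      then show False using assms zdvd_imp_le[of "int n" 2] by simp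
    qed
    show ?thesis
      using True n cross by (auto simp: pos cycle_element_def cycle_vertex_eq_iff doubleton_eq_iff)
  next
    case False
    then have "odd (q - p)" by simp
    then have "\<not> 2 * int n dvd q - p" by (meson dvd_mult_left)
    then show ?thesis using False by (simp add: cycle_element_def)
  qed
  also have "\<dots> \<longleftrightarrow> p mod (2 * int n) = q mod (2 * int n)"
    unfolding mod_eq_dvd_iff by (rule dvd_diff_commute)
  finally show ?thesis .
qed

section \<open>Distances in a cycle\<close>

lemma vdist_le_iff:
  "vdist G u v \<le> enat k \<longleftrightarrow> (\<exists>p. is_path G p \<and> hd p = u \<and> last p = v \<and> length p \<le> Suc k)"
proof -
  have "vdist G u v \<le> enat k \<longleftrightarrow> vdist G u v < enat (Suc k)"
    by (cases "vdist G u v") auto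
  also have "\<dots> \<longleftrightarrow> (\<exists>p. is_path G p \<and> hd p = u \<and> last p = v \<and> length p - 1 < Suc k)"
    by (auto simp: vdist_def INF_less_iff)
  also have "\<dots> \<longleftrightarrow> (\<exists>p. is_path G p \<and> hd p = u \<and> last p = v \<and> length p \<le> Suc k)"
    by (intro arg_cong[where f = Ex] ext) auto
  finally show ?thesis .
qed

text \<open>Each step of a walk moves by \<open>1\<close> or \<open>-1\<close> modulo \<open>n\<close>; adding up the steps bounds the
  displacement by the number of edges. This is the lower bound for distances.\<close>

lemma cycle_walk_displacement:
  assumes "n > 0" "p \<noteq> []" "successively (\<lambda>x y. {x, y} \<in> edges (cycle_graph n)) p"
  shows "\<exists>j. \<bar>j\<bar> < int (length p) \<and> int n dvd int (last p) - int (hd p) - j"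
  using assms(2,3)
proof (induction p rule: induct_list012)
  case 1
  then show ?case by simp
next
  case (2 x)
  then show ?case by (intro exI[of _ 0]) simp
next
  case (3 x y zs)
  then obtain j where j: "\<bar>j\<bar> < int (length (y # zs))"
    "int n dvd int (last (y # zs)) - int y - j"
    by auto
  obtain i where "i < n" "{x, y} = {i, (i + 1) mod n}"
    using 3 by (auto simp: cycle_graph_def)
  then have "int y = (int x + 1) mod int n \<or> int x = (int y + 1) mod int n"
    by (auto simp: doubleton_eq_iff zmod_int add_ac)
  then have "int n dvd (int x + 1) - int y \<or> int n dvd (int y + 1) - int x"
    by (elim disjE) (simp_all only: dvd_minus_mod simp_thms)
  then obtain s where s: "\<bar>s\<bar> = 1" "int n dvd int y - int x - s"
  proof
    assume "int n dvd (int x + 1) - int y"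
    then have "int n dvd - ((int x + 1) - int y)" by (simp only: dvd_minus_iff)
    then show thesis using that[of 1] by (simp add: algebra_simps)
  next
    assume "int n dvd (int y + 1) - int x"
    then show thesis using that[of "-1"] by (simp add: algebra_simps)
  qed
  have "int n dvd int (last (x # y # zs)) - int (hd (x # y # zs)) - (s + j)"
    using dvd_add[OF j(2) s(2)] by (simp add: algebra_simps)
  moreover have "\<bar>s + j\<bar> < int (length (x # y # zs))"
    using s(1) j(1) by auto
  ultimately show ?case by blast
qed

text \<open>The arcs supply the upper bound for distances. An arc with \<open>j \<ge> n\<close> would return to
  its start and repeat a vertex.\<close>

lemma cycle_arc_is_path:
  assumes "0 < n" "j < n"
  shows "is_path (cycle_graph n) (map (\<lambda>i. cycle_vertex n (u + int i)) [0..<Suc j])"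
    (is "is_path _ ?p")
proof -
  have "inj_on (\<lambda>i. cycle_vertex n (u + int i)) {0..<Suc j}"
  proof (rule inj_onI)
    fix a b assume a: "a \<in> {0..<Suc j}" "b \<in> {0..<Suc j}"
      and "cycle_vertex n (u + int a) = cycle_vertex n (u + int b)"
    then have "int n dvd int b - int a" using assms by (simp add: cycle_vertex_eq_iff)
    then have "int b mod int n = int a mod int n" by (simp add: mod_eq_dvd_iff)
    then show "a = b" using a assms by simp
  qed
  then have "distinct ?p" by (simp only: distinct_map set_upt distinct_upt)
  moreover have "set ?p \<subseteq> verts (cycle_graph n)"
    using assms by (auto simp: verts_cycle_graph simp del: upt_Suc)
  moreover have "successively (\<lambda>x y. {x, y} \<in> edges (cycle_graph n)) ?p"
  proof (simp only: successively_conv_nth, intro allI impI)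
    fix i assume "Suc i < length ?p"
    then have "?p ! i = cycle_vertex n (u + int i)" "?p ! Suc i = cycle_vertex n (u + int i + 1)"
      by (simp_all add: algebra_simps del: upt_Suc)
    then show "{?p ! i, ?p ! Suc i} \<in> edges (cycle_graph n)"
      using assms by (auto simp: edges_cycle_graph simp del: upt_Suc)
  qed
  ultimately show ?thesis unfolding is_path_def by simp
qed

lemma is_path_rev: "is_path G (rev p) = is_path G p"
  by (simp add: is_path_def insert_commute)

lemma vdist_cycle_le_iff:
  assumes "n > 0"
  shows "vdist (cycle_graph n) (cycle_vertex n u) (cycle_vertex n v) \<le> enat k \<longleftrightarrow>
    (\<exists>j. \<bar>j\<bar> \<le> int k \<and> int n dvd v - u - j)" (is "?L \<longleftrightarrow> ?R")
proof
  assume ?L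
  then obtain p where p: "is_path (cycle_graph n) p" "hd p = cycle_vertex n u"
    "last p = cycle_vertex n v" "length p \<le> Suc k"
    by (auto simp: vdist_le_iff)
  obtain j where j: "\<bar>j\<bar> < int (length p)" "int n dvd int (last p) - int (hd p) - j"
    using cycle_walk_displacement[OF assms, of p] p(1) by (auto simp: is_path_def)
  have "int n dvd v mod int n - u mod int n - j"
    using j(2) p(2,3) assms by (simp add: cycle_vertex_def)
  moreover have "int n dvd (v - v mod int n) - (u - u mod int n)"
    by (rule dvd_diff) (rule dvd_minus_mod)+
  ultimately have "int n dvd (v mod int n - u mod int n - j) + ((v - v mod int n) - (u - u mod int n))"
    by (rule dvd_add)
  then have "int n dvd v - u - j" by (simp add: algebra_simps)
  then show ?R using j(1) p(4) by (intro exI[of _ j]) auto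
next
  assume ?R
  then obtain j where j: "\<bar>j\<bar> \<le> int k" "int n dvd v - u - j" by blast
  have forward: "vdist (cycle_graph n) (cycle_vertex n a) (cycle_vertex n b) \<le> enat k \<and>
      vdist (cycle_graph n) (cycle_vertex n b) (cycle_vertex n a) \<le> enat k"
    if "0 \<le> i" "i \<le> int k" "int n dvd b - a - i" for a b i
  proof -
    \<comment> \<open>A displacement of at least \<open>n\<close> goes around the cycle; its residue gives an arc that
      visits no vertex twice.\<close>
    define m where "m = nat (i mod int n)"
    have m: "int m = i mod int n" using assms by (simp add: m_def)
    then have "int m < int n" using assms by simp
    then have "m < n" by simp
    have "int m \<le> int k" using that(1,2) m zmod_le_nonneg_dividend[of i "int n"] by linarith
    have "int n dvd i - int m" unfolding m by (simp add: minus_mod_eq_mult_div)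
    then have "int n dvd b - (a + int m)"
      using dvd_add[OF that(3), of "i - int m"] by (simp add: algebra_simps)
    then have b: "cycle_vertex n (a + int m) = cycle_vertex n b"
      using assms by (simp add: cycle_vertex_eq_iff)
    define p where "p = map (\<lambda>i. cycle_vertex n (a + int i)) [0..<Suc m]"
    have p: "is_path (cycle_graph n) p" unfolding p_def
      using cycle_arc_is_path[OF assms \<open>m < n\<close>] .
    have "p \<noteq> []" "hd p = cycle_vertex n a" "last p = cycle_vertex n b" "length p \<le> Suc k"
      using b \<open>int m \<le> int k\<close> by (simp_all add: p_def hd_map last_map del: upt_Suc)
    then show ?thesis
      using p unfolding vdist_le_iff
      by (intro conjI exI[of _ p] exI[of _ "rev p"]) (simp_all add: is_path_rev hd_rev last_rev)
  qed
  show ?L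
  proof (cases "j \<ge> 0")
    case True
    then show ?thesis using forward[of j v u] j by simp
  next
    case False
    have "int n dvd u - v - (- j)" using j(2) dvd_minus_iff[of "int n" "v - u - j"]
      by (simp add: algebra_simps)
    then show ?thesis using forward[of "- j" u v] j(1) False by simp
  qed
qed

lemma add_one_le_enat_Suc_iff: "x + 1 \<le> enat (Suc m) \<longleftrightarrow> x \<le> enat m"
  by (cases x) (auto simp: one_enat_def)

text \<open>The relation "\<open>x\<close> is at distance at most \<open>r\<close> from 0 on a cycle of length \<open>N\<close>".
  The lemmas on it translate between the \<open>n\<close> vertices and the \<open>2 * n\<close> positions of the elements.\<close>

definition near_multiple :: "int \<Rightarrow> int \<Rightarrow> int \<Rightarrow> bool" where
  "near_multiple N r x \<longleftrightarrow> (\<exists>j. \<bar>j\<bar> \<le> r \<and> N dvd x - j)"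

lemma near_multiple_uminus: "near_multiple N r (- x) \<longleftrightarrow> near_multiple N r x"
proof -
  have "near_multiple N r (- x)" if near: "near_multiple N r x" for x
  proof -
    obtain j where j: "\<bar>j\<bar> \<le> r" "N dvd x - j"
      using near by (auto simp: near_multiple_def)
    have "N dvd - x - - j" using j(2) dvd_minus_iff[of N "x - j"] by simp
    then show ?thesis using j(1) unfolding near_multiple_def by (intro exI[of _ "- j"]) simp
  qed
  from this[of x] this[of "- x"] show ?thesis by auto
qed

lemma near_multiple_double:
  "near_multiple (2 * N) (2 * r) (2 * x) \<longleftrightarrow> near_multiple N r x"
proof
  assume "near_multiple (2 * N) (2 * r) (2 * x)"
  then obtain j where j: "\<bar>j\<bar> \<le> 2 * r" "2 * N dvd 2 * x - j"
    by (auto simp: near_multiple_def)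
  have "even j" using dvd_mult_left[OF j(2)] by simp
  then obtain i where "j = 2 * i" by (elim evenE)
  then show "near_multiple N r x"
    using j unfolding near_multiple_def
    by (intro exI[of _ i]) (simp add: two_times_dvd_diff_iff)
next
  assume "near_multiple N r x"
  then obtain j where "\<bar>j\<bar> \<le> r" "N dvd x - j"
    by (auto simp: near_multiple_def)
  then show "near_multiple (2 * N) (2 * r) (2 * x)"
    unfolding near_multiple_def
    by (intro exI[of _ "2 * j"]) (simp add: two_times_dvd_diff_iff)
qed

text \<open>The left side measures the displacement from a vertex to an edge in positions. On the right
  stand the displacements to the two ends of the edge, in vertices; by definition, the distance to
  the edge is one more than the distance to the nearer end. The next lemma serves in the same way
  for two edges.\<close>

lemma near_multiple_double_plus_one:
  assumes "r \<ge> 0"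
  shows "near_multiple (2 * N) (2 * (r + 1)) (2 * x + 1) \<longleftrightarrow>
    near_multiple N r x \<or> near_multiple N r (x + 1)"
proof
  assume "near_multiple (2 * N) (2 * (r + 1)) (2 * x + 1)"
  then obtain j where j: "\<bar>j\<bar> \<le> 2 * (r + 1)" "2 * N dvd 2 * x + 1 - j"
    by (auto simp: near_multiple_def)
  have "odd j" using dvd_mult_left[OF j(2)] by simp
  then obtain i where i: "j = 2 * i + 1" by (elim oddE)
  have dvd: "N dvd x - i" using j(2) two_times_dvd_diff_iff[of N x i] by (simp add: i)
  consider "\<bar>i\<bar> \<le> r" | "\<bar>i + 1\<bar> \<le> r" using j(1) i assms by (cases "i \<ge> 0") auto
  then show "near_multiple N r x \<or> near_multiple N r (x + 1)"
  proof cases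
    case 1
    then show ?thesis using dvd unfolding near_multiple_def by blast
  next
    case 2
    moreover have "N dvd (x + 1) - (i + 1)" using dvd by simp
    ultimately show ?thesis unfolding near_multiple_def by blast
  qed
next
  assume "near_multiple N r x \<or> near_multiple N r (x + 1)"
  then obtain i where i: "\<bar>i\<bar> \<le> r \<or> \<bar>i + 1\<bar> \<le> r" "N dvd x - i"
  proof (elim disjE)
    assume "near_multiple N r (x + 1)"
    then obtain j where "\<bar>j\<bar> \<le> r" "N dvd x + 1 - j"
      by (auto simp: near_multiple_def)
    then show thesis using that[of "j - 1"] by (simp add: algebra_simps)
  qed (use that in \<open>auto simp: near_multiple_def\<close>)
  have "2 * N dvd 2 * x + 1 - (2 * i + 1)"
    using i(2) two_times_dvd_diff_iff[of N x i] by simp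
  moreover have "\<bar>2 * i + 1\<bar> \<le> 2 * (r + 1)" using i(1) by auto
  ultimately show "near_multiple (2 * N) (2 * (r + 1)) (2 * x + 1)"
    unfolding near_multiple_def by blast
qed

lemma near_multiple_widen:
  assumes "r \<ge> 0"
  shows "near_multiple N (r + 1) x \<longleftrightarrow>
    near_multiple N r (x - 1) \<or> near_multiple N r x \<or> near_multiple N r (x + 1)"
proof
  assume "near_multiple N (r + 1) x"
  then obtain i where i: "\<bar>i\<bar> \<le> r + 1" "N dvd x - i"
    by (auto simp: near_multiple_def)
  consider "\<bar>i\<bar> \<le> r" | "\<bar>i - 1\<bar> \<le> r" | "\<bar>i + 1\<bar> \<le> r"
    using i(1) assms by linarith
  then show "near_multiple N r (x - 1) \<or> near_multiple N r x \<or> near_multiple N r (x + 1)"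
  proof cases
    case 1
    then show ?thesis using i(2) unfolding near_multiple_def by blast
  next
    case 2
    moreover have "N dvd (x - 1) - (i - 1)" using i(2) by simp
    ultimately show ?thesis unfolding near_multiple_def by blast
  next
    case 3
    moreover have "N dvd (x + 1) - (i + 1)" using i(2) by simp
    ultimately show ?thesis unfolding near_multiple_def by blast
  qed
next
  have shift: "near_multiple N (r + 1) x"
    if near: "near_multiple N r (x + s)" and s: "\<bar>s\<bar> \<le> 1" for s
  proof -
    obtain j where j: "\<bar>j\<bar> \<le> r" "N dvd x + s - j"
      using near by (auto simp: near_multiple_def)
    have "\<bar>j - s\<bar> \<le> r + 1" using j(1) s by linarith
    moreover have "N dvd x - (j - s)" using j(2) by (simp add: algebra_simps)
    ultimately show ?thesis unfolding near_multiple_def by blast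
  qed
  assume "near_multiple N r (x - 1) \<or> near_multiple N r x \<or> near_multiple N r (x + 1)"
  then show "near_multiple N (r + 1) x"
    using shift[of "- 1"] shift[of 0] shift[of 1] by auto
qed

text \<open>The case \<open>m = 0\<close> is different: by the formula that defines it for pairs of edges, the
  distance of an edge to itself is 1.\<close>

lemma edist_cycle_le_iff:
  assumes "n > 0" "m > 0"
  shows "edist (cycle_graph n) (cycle_element n p) (cycle_element n q) \<le> enat m \<longleftrightarrow>
    near_multiple (2 * int n) (2 * int m) (q - p)" (is "?L \<longleftrightarrow> ?R")
proof -
  obtain k where k: "m = Suc k" using assms(2) by (cases m) auto
  then have m: "int m = int k + 1" by simp
  define u v where "u = p div 2" and "v = q div 2"
  have vdist: "vdist (cycle_graph n) (cycle_vertex n a) (cycle_vertex n b) \<le> enat i \<longleftrightarrow>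
      near_multiple (int n) (int i) (b - a)" for a b i
    using vdist_cycle_le_iff[OF assms(1)] by (simp add: near_multiple_def)
  note edist = cycle_element_def add_one_le_enat_Suc_iff vdist inf_min min_le_iff_disj
  have "p = 2 * u \<or> p = 2 * u + 1" "q = 2 * v \<or> q = 2 * v + 1"
    unfolding u_def v_def by (cases "even p"; cases "even q"; simp)+
  then consider "p = 2 * u" "q = 2 * v" | "p = 2 * u" "q = 2 * v + 1"
    | "p = 2 * u + 1" "q = 2 * v" | "p = 2 * u + 1" "q = 2 * v + 1"
    by blast
  then show ?thesis
  proof cases
    case 1
    have "?L \<longleftrightarrow> near_multiple (int n) (int m) (v - u)"
      by (simp add: 1 edist)
    also have "\<dots> \<longleftrightarrow> ?R"
      using near_multiple_double[of "int n" "int m" "v - u"] by (simp add: 1 right_diff_distrib)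
    finally show ?thesis .
  next
    case 2
    have "?L \<longleftrightarrow> near_multiple (int n) (int k) (v - u) \<or> near_multiple (int n) (int k) (v - u + 1)"
      by (simp add: 2 edist k diff_add_eq)
    also have "\<dots> \<longleftrightarrow> ?R"
      using near_multiple_double_plus_one[of "int k" "int n" "v - u"]
      by (simp add: 2 m algebra_simps)
    finally show ?thesis .
  next
    case 3
    have "?L \<longleftrightarrow> near_multiple (int n) (int k) (u - v) \<or> near_multiple (int n) (int k) (u - v + 1)"
      by (simp add: 3 edist k diff_add_eq)
    also have "\<dots> \<longleftrightarrow> near_multiple (2 * int n) (2 * int m) (2 * (u - v) + 1)"
      using near_multiple_double_plus_one[of "int k" "int n" "u - v"] by (simp add: m)
    also have "\<dots> \<longleftrightarrow> ?R"
      using near_multiple_uminus[of "2 * int n" "2 * int m" "2 * (u - v) + 1"]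
      by (simp add: 3 algebra_simps)
    finally show ?thesis .
  next
    case 4
    have "?L \<longleftrightarrow> near_multiple (int n) (int k) (v - u - 1) \<or> near_multiple (int n) (int k) (v - u) \<or>
        near_multiple (int n) (int k) (v - u + 1)"
      by (simp add: 4 edist k diff_add_eq diff_diff_eq) blast
    also have "\<dots> \<longleftrightarrow> near_multiple (int n) (int m) (v - u)"
      using near_multiple_widen[of "int k" "int n" "v - u"] by (simp add: m)
    also have "\<dots> \<longleftrightarrow> ?R"
      using near_multiple_double[of "int n" "int m" "v - u"] by (simp add: 4 right_diff_distrib)
    finally show ?thesis .
  qed
qed

section \<open>Colourings as periodic words\<close>

text \<open>Words over \<open>{1..k}\<close> of period \<open>N\<close> in which every window of five letters is rainbow.\<close>

definition rainbow_word :: "nat \<Rightarrow> nat \<Rightarrow> (int \<Rightarrow> nat) \<Rightarrow> bool" where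
  "rainbow_word N k f \<longleftrightarrow> range f \<subseteq> {1..k} \<and> (\<forall>p. f (p mod int N) = f p) \<and>
     (\<forall>p j. 1 \<le> j \<and> j \<le> 4 \<longrightarrow> f (p + j) \<noteq> f p)"

lemma rainbow_wordD:
  assumes "rainbow_word N k f"
  shows "f p \<in> {1..k}" and "p mod int N = q mod int N \<Longrightarrow> f p = f q"
    and "1 \<le> j \<Longrightarrow> j \<le> 4 \<Longrightarrow> f (p + j) \<noteq> f p"
proof -
  show "f p \<in> {1..k}" using assms unfolding rainbow_word_def by blast
  have "f (x mod int N) = f x" for x
    using assms unfolding rainbow_word_def by blast
  from this[of p] this[of q] show "f p = f q" if "p mod int N = q mod int N"
    using that by simp
  show "f (p + j) \<noteq> f p" if "1 \<le> j" "j \<le> 4"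
    using assms that unfolding rainbow_word_def by blast
qed

text \<open>Distance at most 2 between elements means at most 4 positions apart. As \<open>2 * n > 4\<close>,
  positions with a difference from 1 to 4 carry distinct elements, so the word cannot repeat a
  letter within such a window.\<close>

lemma ex_coloring_iff_ex_rainbow_word:
  assumes "n \<ge> 3"
  shows "(\<exists>c. packing_total_coloring (\<lambda>i. 2) (cycle_graph n) k c) \<longleftrightarrow>
    (\<exists>f. rainbow_word (2 * n) k f)" (is "?L \<longleftrightarrow> ?R")
proof
  assume ?L
  then obtain c where c: "packing_total_coloring (\<lambda>i. 2) (cycle_graph n) k c" by blast
  then have range: "c ` elements (cycle_graph n) \<subseteq> {1..k}"
    unfolding packing_total_coloring_def by (elim conjE)
  have far: "\<And>A B. A \<in> elements (cycle_graph n) \<Longrightarrow> B \<in> elements (cycle_graph n) \<Longrightarrow>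
      A \<noteq> B \<Longrightarrow> c A = c B \<Longrightarrow> edist (cycle_graph n) A B > enat 2" for A B
    using c unfolding packing_total_coloring_def by (elim conjE) blast
  define f where "f = (\<lambda>p. c (cycle_element n p))"
  have elem: "cycle_element n p \<in> elements (cycle_graph n)" for p
    using assms by (simp add: elements_cycle_graph)
  have "f (p + j) \<noteq> f p" if j: "1 \<le> j" "j \<le> 4" for p j
  proof
    assume "f (p + j) = f p"
    have "\<not> 2 * int n dvd j" using j assms by (auto dest: zdvd_imp_le)
    then have "cycle_element n p \<noteq> cycle_element n (p + j)"
      using assms by (simp add: cycle_element_eq_iff mod_eq_dvd_iff)
    moreover have "near_multiple (2 * int n) (2 * int 2) (p + j - p)"
      unfolding near_multiple_def using j by (intro exI[of _ j]) simp
    then have "edist (cycle_graph n) (cycle_element n p) (cycle_element n (p + j)) \<le> enat 2"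
      using assms edist_cycle_le_iff[of n 2] by simp
    ultimately show False
      using far[OF elem elem, of p "p + j"] \<open>f (p + j) = f p\<close> by (simp add: f_def)
  qed
  moreover have "f (p mod int (2 * n)) = f p" for p
  proof -
    have "cycle_element n (p mod int (2 * n)) = cycle_element n p"
      using assms by (simp add: cycle_element_eq_iff)
    then show ?thesis by (simp add: f_def)
  qed
  moreover have "range f \<subseteq> {1..k}" using range elem unfolding f_def by blast
  ultimately show ?R unfolding rainbow_word_def by blast
next
  assume ?R
  then obtain f where f: "rainbow_word (2 * n) k f" by blast
  define c where "c = (\<lambda>A. f (SOME p. cycle_element n p = A))"
  have c: "c (cycle_element n p) = f p" for p
  proof -
    have "cycle_element n (SOME q. cycle_element n q = cycle_element n p) = cycle_element n p"
      by (rule someI) (rule refl)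
    then show ?thesis
      unfolding c_def using assms by (intro rainbow_wordD(2)[OF f]) (simp add: cycle_element_eq_iff)
  qed
  have "edist (cycle_graph n) (cycle_element n p) (cycle_element n q) > enat 2"
    if neq: "cycle_element n p \<noteq> cycle_element n q" and same: "f p = f q" for p q
  proof (rule ccontr)
    assume "\<not> ?thesis"
    then have "edist (cycle_graph n) (cycle_element n p) (cycle_element n q) \<le> enat 2"
      by (simp only: not_less)
    then have "near_multiple (2 * int n) (2 * int 2) (q - p)"
      using assms edist_cycle_le_iff[of n 2 p q] by simp
    then obtain j where j: "\<bar>j\<bar> \<le> 4" "2 * int n dvd q - p - j"
      by (auto simp: near_multiple_def)
    have "2 * int n dvd q - (p + j)" using j(2) by (simp add: algebra_simps)
    then have q: "q mod int (2 * n) = (p + j) mod int (2 * n)" by (simp add: mod_eq_dvd_iff)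
    then have "f (p + j) = f p" using same rainbow_wordD(2)[OF f q] by simp
    moreover have "j \<noteq> 0" using neq q assms by (auto simp: cycle_element_eq_iff)
    then consider "1 \<le> j" | "1 \<le> - j" by linarith
    then have "f (p + j) \<noteq> f p"
    proof cases
      case 1
      then show ?thesis using rainbow_wordD(3)[OF f] j(1) by simp
    next
      case 2
      then show ?thesis using rainbow_wordD(3)[OF f, of "- j" "p + j"] j(1) by simp
    qed
    ultimately show False by blast
  qed
  moreover have "f p \<in> {1..k}" for p using rainbow_wordD(1)[OF f] .
  ultimately have "packing_total_coloring (\<lambda>i. 2) (cycle_graph n) k c"
    using assms unfolding packing_total_coloring_def packing_sequence_def
    by (auto simp: elements_cycle_graph c)
  then show ?L by blast
qed

section \<open>The lower bound\<close>

text \<open>The windows of length 5 that start at the occurrences of a fixed letter are disjoint modulo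
  \<open>N\<close>, so there are at most \<open>N div 5\<close> occurrences in a period. Sum over the letters.\<close>

lemma rainbow_word_period_le:
  assumes f: "rainbow_word N k f" and "N > 0"
  shows "N \<le> k * (N div 5)"
proof -
  define P where "P = {0..<int N}"
  define F where "F = (\<lambda>i. {p \<in> P. f p = i})"
  have card_F: "card (F i) \<le> N div 5" for i
  proof -
    \<comment> \<open>Disjointness of the windows is injectivity of the map that sends a start and an offset
      to a position.\<close>
    define shift where "shift = (\<lambda>(p, d). (p + d) mod int N)"
    have step: "p = q \<and> d = e"
      if p: "p \<in> F i" and q: "q \<in> F i" and de: "0 \<le> d" "d \<le> e" "e \<le> (4::int)"
        and eq: "(p + d) mod int N = (q + e) mod int N" for p q d e
    proof -
      have "int N dvd p - (q + (e - d))"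
        using eq by (simp add: mod_eq_dvd_iff algebra_simps)
      then have mod: "p mod int N = (q + (e - d)) mod int N" by (simp add: mod_eq_dvd_iff)
      then have "f (q + (e - d)) = f q"
        using p q rainbow_wordD(2)[OF f mod] by (simp add: F_def)
      then have "\<not> 1 \<le> e - d" using rainbow_wordD(3)[OF f, of "e - d" q] de by auto
      then have "d = e" using de by simp
      then show ?thesis using mod p q by (simp add: F_def P_def)
    qed
    have "inj_on shift (F i \<times> {0..4})"
    proof (rule inj_onI)
      fix x y assume xy: "x \<in> F i \<times> {0..4}" "y \<in> F i \<times> {0..4}" "shift x = shift y"
      obtain p d q e where pq: "x = (p, d)" "y = (q, e)" by (cases x, cases y) auto
      show "x = y"
      proof (cases "d \<le> e")
        case True
        then show ?thesis using step[of p q d e] xy pq by (simp add: shift_def)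
      next
        case False
        then show ?thesis using step[of q p e d] xy pq by (simp add: shift_def)
      qed
    qed
    moreover have "shift ` (F i \<times> {0..4}) \<subseteq> P"
      using \<open>N > 0\<close> by (auto simp: shift_def P_def)
    ultimately have "card (F i \<times> {0..4::int}) \<le> card P"
      using card_inj_on_le[of shift _ P] by (simp add: P_def)
    then have "card (F i) * 5 \<le> N" by (simp add: card_cartesian_product P_def)
    then show ?thesis by simp
  qed
  have "N = card P" by (simp add: P_def)
  also have "P = (\<Union>i\<in>{1..k}. F i)"
    using rainbow_wordD(1)[OF f] by (auto simp: F_def)
  also have "card (\<Union>i\<in>{1..k}. F i) \<le> (\<Sum>i\<in>{1..k}. card (F i))" by (rule card_UN_le) simp
  also have "\<dots> \<le> (\<Sum>i\<in>{1..k}. N div 5)" by (intro sum_mono card_F)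
  finally show ?thesis by simp
qed

section \<open>Words with few letters\<close>

lemma rainbow_word_mod:
  assumes "m dvd N" "m \<ge> 5"
  shows "rainbow_word N m (\<lambda>p. nat (p mod int m) + 1)"
proof -
  have "nat (p mod int m) + 1 \<in> {1..m}" for p
    using assms pos_mod_bound[of "int m" p] by (auto simp: nat_less_iff Suc_le_eq)
  moreover have "p mod int N mod int m = p mod int m" for p
    using assms by (intro mod_mod_cancel) simp
  moreover have "nat ((p + j) mod int m) + 1 \<noteq> nat (p mod int m) + 1" if j: "1 \<le> j" "j \<le> 4" for p j
  proof
    assume "nat ((p + j) mod int m) + 1 = nat (p mod int m) + 1"
    then have "(p + j) mod int m = p mod int m"
      using assms by (simp add: eq_nat_nat_iff)
    then have "int m dvd j" by (simp add: mod_eq_dvd_iff)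
    then show False using j assms zdvd_imp_le[of "int m" j] by linarith
  qed
  ultimately show ?thesis unfolding rainbow_word_def by auto
qed

text \<open>Put the \<open>b\<close> blocks of length 6 first, then the \<open>a\<close> blocks of length 5. The
  letter is determined by the place within the block, so the earliest position where it can recur
  is the same place of the next block, which is 5 or 6 positions later.\<close>

lemma rainbow_word_blocks:
  assumes "N = 5 * a + 6 * b" "N > 0"
  shows "\<exists>f. rainbow_word N 6 f"
proof -
  define g :: "int \<Rightarrow> int" where
    "g = (\<lambda>x. if x < 6 * int b then x mod 6 else (x - 6 * int b) mod 5)"
  define f where "f = (\<lambda>p. nat (g (p mod int N)) + 1)"
  have g_six: "g x = x mod 6" if "x < 6 * int b" for x using that by (simp add: g_def)
  have g_five: "g x = (x - 6 * int b) mod 5" if "6 * int b \<le> x" for x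
    using that by (simp add: g_def)
  have g_bounds: "0 \<le> g x \<and> g x < 6" for x
  proof (cases "x < 6 * int b")
    case True
    then show ?thesis by (simp add: g_six)
  next
    case False
    have "0 \<le> (x - 6 * int b) mod 5" "(x - 6 * int b) mod 5 < 5" by simp_all
    then show ?thesis using g_five[of x] False by linarith
  qed
  have g_init: "g x = x" if "0 \<le> x" "x < 5" for x
    using that by (cases "b = 0") (simp_all add: g_five g_six)
  have g_six_end: "g x = x - 6 * int b + 6" if "6 * int b - 4 \<le> x" "x < 6 * int b" for x
    unfolding g_six[OF that(2)] using that by (intro int_mod_pos_eq[where q = "int b - 1"]) simp_all
  \<comment> \<open>The period ends with 4 or 5, whichever block comes last. With \<open>g_init\<close> this handles the
    windows that wrap around: a window of five letters cannot reach from a letter \<open>g x\<close> near the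
    end to the same letter at the start of the next period.\<close>
  have g_final: "5 \<le> g x + (int N - x)" if x: "int N - 4 \<le> x" "x < int N" for x
  proof (cases "a = 0")
    case True
    then show ?thesis using g_six_end[of x] x assms(1) by simp
  next
    case False
    then have le: "6 * int b \<le> x" using x assms(1) by simp
    have "g x = x - int N + 5" unfolding g_five[OF le]
      using x assms(1) by (intro int_mod_pos_eq[where q = "int a - 1"]) simp_all
    then show ?thesis by simp
  qed
  have g_step: "g (x + j) \<noteq> g x" if j: "1 \<le> j" "j \<le> 4" for x j
  proof -
    have distinct: "(y + j) mod m \<noteq> y mod m" if "m \<ge> 5" for y m
    proof
      assume "(y + j) mod m = y mod m"
      then have "m dvd j" by (simp add: mod_eq_dvd_iff)
      then show False using j that zdvd_imp_le[of m j] by linarith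
    qed
    consider "x + j < 6 * int b" | "6 * int b \<le> x" | "x < 6 * int b" "6 * int b \<le> x + j"
      by linarith
    then show ?thesis
    proof cases
      case 1
      then show ?thesis using distinct[of 6 x] j by (simp add: g_six)
    next
      case 2
      then show ?thesis using distinct[of 5 "x - 6 * int b"] j by (simp add: g_five diff_add_eq)
    next
      case 3
      have "g (x + j) = x + j - 6 * int b" unfolding g_five[OF 3(2)]
        using 3 j by (intro int_mod_pos_eq[where q = 0]) simp_all
      moreover have "g x = x - 6 * int b + 6" using g_six_end[of x] 3 j by simp
      ultimately show ?thesis using j by simp
    qed
  qed
  have "f (p + j) \<noteq> f p" if j: "1 \<le> j" "j \<le> 4" for p j
  proof -
    define x where "x = p mod int N"
    have x: "0 \<le> x" "x < int N" using assms(2) by (simp_all add: x_def)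
    have N5: "int N \<ge> 5" using assms by (cases "a = 0") auto
    have xj: "(p + j) mod int N = (x + j) mod int N" by (simp add: x_def mod_add_left_eq)
    have "g ((x + j) mod int N) \<noteq> g x"
    proof (cases "x + j < int N")
      case True
      then show ?thesis using g_step[of j x] x j by simp
    next
      case False
      then have "(x + j) mod int N = x + j - int N"
        using x j N5 by (intro int_mod_pos_eq[where q = 1]) auto
      then show ?thesis using g_init[of "x + j - int N"] g_final[of x] False x j by simp
    qed
    then show ?thesis
      using g_bounds xj by (simp add: f_def x_def eq_nat_nat_iff)
  qed
  moreover have "f p \<in> {1..6}" for p
    using g_bounds[of "p mod int N"] by (auto simp: f_def)
  moreover have "f (p mod int N) = f p" for p by (simp add: f_def)
  ultimately have "rainbow_word N 6 f" unfolding rainbow_word_def by blast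
  then show ?thesis by blast
qed

text \<open>Enlarge \<open>N mod 5\<close> of the \<open>N div 5\<close> fives to sixes.\<close>

lemma five_six_representable:
  fixes N :: nat
  assumes "N mod 5 \<le> N div 5"
  shows "\<exists>a b. N = 5 * a + 6 * b"
proof -
  have "N = 5 * (N div 5 - N mod 5) + 6 * (N mod 5)"
    using assms mult_div_mod_eq[of 5 N] by linarith
  then show ?thesis by blast
qed

theorem proposition18:
  fixes n :: nat
  assumes "n \<ge> 3"
  shows "packing_total_chromatic_number (\<lambda>i. 2) (cycle_graph n) =
    (if n mod 5 = 0 then 5
     else if n \<notin> {4, 7} then 6
     else if n = 7 then 7
     else 8)"
    (is "_ = ?k")
proof -
  have attained: "\<exists>f. rainbow_word (2 * n) ?k f"
  proof -
    consider "n mod 5 = 0" | "n = 7" | "n = 4" | "n mod 5 \<noteq> 0" "n \<noteq> 7" "n \<noteq> 4" by blast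
    then show ?thesis
    proof cases
      case 1
      then show ?thesis using rainbow_word_mod[of 5 "2 * n"] by auto
    next
      case 2
      then show ?thesis using rainbow_word_mod[of 7 "2 * n"] by auto
    next
      case 3
      then show ?thesis using rainbow_word_mod[of 8 "2 * n"] by auto
    next
      case 4
      have "(2 * n) mod 5 \<le> (2 * n) div 5"
      proof (cases "n \<ge> 10")
        case True
        then have "20 div 5 \<le> (2 * n) div 5" by (intro div_le_mono) simp
        moreover have "(2 * n) mod 5 < 5" by simp
        ultimately show ?thesis by linarith
      next
        case False
        then consider "n = 3" | "n = 5" | "n = 6" | "n = 8" | "n = 9"
          using 4 assms by linarith
        then show ?thesis by cases simp_all
      qed
      then obtain a b where "2 * n = 5 * a + 6 * b" using five_six_representable by blast
      then have "\<exists>f. rainbow_word (2 * n) 6 f"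
        by (rule rainbow_word_blocks) (use assms in simp)
      then show ?thesis using 4 by simp
    qed
  qed
  have least: "?k \<le> k" if "rainbow_word (2 * n) k f" for k f
  proof -
    have count: "2 * n \<le> k * (2 * n div 5)"
      using rainbow_word_period_le[OF that] assms by simp
    have "5 \<le> k"
    proof (rule ccontr)
      assume "\<not> 5 \<le> k"
      then have "k * (2 * n div 5) \<le> 4 * (2 * n div 5)" by (intro mult_le_mono1) simp
      then show False using count assms by linarith
    qed
    moreover have "n mod 5 = 0" if "k = 5"
    proof -
      have "2 * n \<le> 5 * (2 * n div 5)" using count that by simp
      then have "(2 * n) mod 5 = 0" using mult_div_mod_eq[of 5 "2 * n"] by linarith
      then have "5 dvd 2 * n" by (rule mod_0_imp_dvd)
      \<comment> \<open>The difference is \<open>n\<close>: 3 is the inverse of 2 modulo 5.\<close>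
      then have "5 dvd 3 * (2 * n) - 5 * n" by (rule dvd_diff_nat[OF dvd_mult dvd_triv_left])
      then show ?thesis by (simp add: dvd_eq_mod_eq_0)
    qed
    moreover have "8 \<le> k" if "n = 4" using count that by simp
    moreover have "7 \<le> k" if "n = 7" using count that by simp
    ultimately show ?thesis by (cases "k = 5") auto
  qed
  show ?thesis
    unfolding packing_total_chromatic_number_def ex_coloring_iff_ex_rainbow_word[OF assms]
  proof (rule Least_equality)
    fix k assume "\<exists>f. rainbow_word (2 * n) k f"
    then show "?k \<le> k" by (elim exE) (rule least)
  qed (rule attained)
qed

end
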